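(* Fix $n\ge 3$, and let $\lambda:L_n\longrightarrow \mathrm{GL}_n(\mathbb{C})$ be a non-trivial complex homogeneous $2$-local representation of the triplet group $L_n$. Then there exists $b\in\mathbb{C}^*$ such that for all $1\le i\le n-1$, \[ \lambda(\ell_i)= \begin{pmatrix} I_{i-1} & 0 & 0 \\ 0 & \begin{pmatrix} 0 & b \\ \frac{1}{b} & 0 \end{pmatrix} & 0 \\ 0 & 0 & I_{n-i-1} \end{pmatrix}. \]
   Context: The triplet group $L_n$ is the group generated by $\ell_1,\ldots,\ell_{n-1}$ subject to the relations $\ell_i^2=1$ for $1\le i\le n-1$ and $\ell_i\ell_{i+1}\ell_i=\ell_{i+1}\ell_i\ell_{i+1}$ for $1\le i\le n-2$ (no commutation relations are imposed). A representation $\lambda:L_n\to\mathrm{GL}_n(\mathbb{C})$ is $2$-local if for each $1\le i\le n-1$ the matrix $\lambda(\ell_i)$ is block diagonal with diagonal blocks $I_{i-1}, M_i, I_{n-i-1}$ for some $M_i\in\mathrm{GL}_2(\mathbb{C})$, where $I_r$ is the $r\times r$ identity matrix. It is homogeneous if all the $M_i$ are equal. It is non-trivial if it is not the representation sending every generator to the identity matrix. *)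

theory Defs
  imports "HOL-Algebra.Group" "Jordan_Normal_Form.Matrix"
begin

section \<open>Groups given by generators and relations\<close>

text \<open>A letter \<open>(x, True)\<close> stands for the generator \<open>x\<close>, and \<open>(x, False)\<close> for its formal inverse.
  A relation is a pair \<open>(u, v)\<close> of words, read as \<open>u = v\<close>.\<close>

type_synonym 'a gword = "('a \<times> bool) list"

definition gwords :: "'a set \<Rightarrow> 'a gword set" where
  "gwords X = lists (X \<times> UNIV)"

inductive pres_cong :: "'a set \<Rightarrow> ('a gword \<times> 'a gword) set \<Rightarrow> 'a gword \<Rightarrow> 'a gword \<Rightarrow> bool"
  for X R where
  refl: "u \<in> gwords X \<Longrightarrow> pres_cong X R u u"
| sym: "pres_cong X R u v \<Longrightarrow> pres_cong X R v u"
| trans: "pres_cong X R u v \<Longrightarrow> pres_cong X R v w \<Longrightarrow> pres_cong X R u w"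
| append: "pres_cong X R u u' \<Longrightarrow> pres_cong X R v v' \<Longrightarrow> pres_cong X R (u @ v) (u' @ v')"
| cancel: "x \<in> X \<Longrightarrow> pres_cong X R [(x, e), (x, \<not> e)] []"
| relation: "(u, v) \<in> R \<Longrightarrow> u \<in> gwords X \<Longrightarrow> v \<in> gwords X \<Longrightarrow> pres_cong X R u v"

definition pres_class :: "'a set \<Rightarrow> ('a gword \<times> 'a gword) set \<Rightarrow> 'a gword \<Rightarrow> 'a gword set" where
  "pres_class X R u = {v. pres_cong X R u v}"

definition presented_group :: "'a set \<Rightarrow> ('a gword \<times> 'a gword) set \<Rightarrow> 'a gword set monoid" where
  "presented_group X R =
    \<lparr>carrier = pres_class X R ` gwords X,
     mult = (\<lambda>A B. \<Union>u\<in>A. \<Union>v\<in>B. pres_class X R (u @ v)),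
     one = pres_class X R []\<rparr>"

definition pres_gen :: "'a set \<Rightarrow> ('a gword \<times> 'a gword) set \<Rightarrow> 'a \<Rightarrow> 'a gword set" where
  "pres_gen X R x = pres_class X R [(x, True)]"

lemma gwords_simps [simp]:
  "[] \<in> gwords X"
  "p # u \<in> gwords X \<longleftrightarrow> fst p \<in> X \<and> u \<in> gwords X"
  "u @ v \<in> gwords X \<longleftrightarrow> u \<in> gwords X \<and> v \<in> gwords X"
  by (auto simp: gwords_def mem_Times_iff)

lemma pres_cong_gwords:
  "pres_cong X R u v \<Longrightarrow> u \<in> gwords X \<and> v \<in> gwords X"
  by (induction rule: pres_cong.induct) auto

lemma pres_class_eq_iff:
  "u \<in> gwords X \<Longrightarrow> pres_class X R u = pres_class X R v \<longleftrightarrow> pres_cong X R u v"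
  unfolding pres_class_def set_eq_iff mem_Collect_eq
  by (meson pres_cong.refl pres_cong.sym pres_cong.trans)

lemma presented_group_mult:
  assumes "u \<in> gwords X" "v \<in> gwords X"
  shows "pres_class X R u \<otimes>\<^bsub>presented_group X R\<^esub> pres_class X R v = pres_class X R (u @ v)"
proof -
  have "pres_class X R (a @ b) = pres_class X R (u @ v)"
    if "a \<in> pres_class X R u" "b \<in> pres_class X R v" for a b
  proof -
    have "pres_cong X R (u @ v) (a @ b)"
      using that by (intro pres_cong.append) (simp_all add: pres_class_def)
    then have "pres_class X R (u @ v) = pres_class X R (a @ b)"
      using assms by (subst pres_class_eq_iff) simp_all
    then show ?thesis by (rule HOL.sym)
  qed
  moreover have "u \<in> pres_class X R u" "v \<in> pres_class X R v"
    using assms by (auto simp: pres_class_def intro: pres_cong.refl)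
  ultimately have "(\<Union>a\<in>pres_class X R u. \<Union>b\<in>pres_class X R v. pres_class X R (a @ b))
      = pres_class X R (u @ v)"
    by blast
  then show ?thesis
    by (simp add: presented_group_def)
qed

definition gword_inv :: "'a gword \<Rightarrow> 'a gword" where
  "gword_inv u = rev (map (\<lambda>(x, e). (x, \<not> e)) u)"

lemma gword_inv_gwords [simp]: "u \<in> gwords X \<Longrightarrow> gword_inv u \<in> gwords X"
  by (auto simp: gwords_def gword_inv_def)

lemma pres_cong_inv_left: "u \<in> gwords X \<Longrightarrow> pres_cong X R (gword_inv u @ u) []"
proof (induction u)
  case Nil
  then show ?case by (simp add: gword_inv_def pres_cong.refl)
next
  case (Cons p u)
  obtain x e where p: "p = (x, e)" by fastforce
  have x: "x \<in> X" and u: "u \<in> gwords X" using Cons.prems p by auto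
  have "pres_cong X R ([(x, \<not> e), (x, e)] @ u) ([] @ u)"
    using pres_cong.cancel[OF x, of R "\<not> e"] u by (intro pres_cong.append pres_cong.refl) auto
  then have "pres_cong X R (gword_inv u @ ([(x, \<not> e), (x, e)] @ u)) (gword_inv u @ u)"
    using u by (intro pres_cong.append pres_cong.refl) auto
  then show ?case
    using pres_cong.trans[OF _ Cons.IH[OF u]] p by (simp add: gword_inv_def)
qed

lemma presented_group_group: "group (presented_group X R)"
proof (rule groupI)
  fix A assume "A \<in> carrier (presented_group X R)"
  then obtain u where u: "u \<in> gwords X" "A = pres_class X R u"
    by (auto simp: presented_group_def)
  have "pres_class X R (gword_inv u) \<in> carrier (presented_group X R)"
    using u by (auto simp: presented_group_def)
  moreover have "pres_class X R (gword_inv u) \<otimes>\<^bsub>presented_group X R\<^esub> A = \<one>\<^bsub>presented_group X R\<^esub>"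
    using u pres_cong_inv_left[of u X R]
    by (simp add: presented_group_mult) (simp add: presented_group_def pres_class_eq_iff)
  ultimately show "\<exists>B\<in>carrier (presented_group X R).
      B \<otimes>\<^bsub>presented_group X R\<^esub> A = \<one>\<^bsub>presented_group X R\<^esub>"
    by blast
next
  have one: "\<one>\<^bsub>presented_group X R\<^esub> = pres_class X R []"
    by (simp add: presented_group_def)
  have carr: "carrier (presented_group X R) = pres_class X R ` gwords X"
    by (simp add: presented_group_def)
  show "\<one>\<^bsub>presented_group X R\<^esub> \<in> carrier (presented_group X R)"
    by (auto simp: one carr)
  show "\<one>\<^bsub>presented_group X R\<^esub> \<otimes>\<^bsub>presented_group X R\<^esub> A = A"
    if "A \<in> carrier (presented_group X R)" for A
    using that by (auto simp: one carr presented_group_mult)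
  show "A \<otimes>\<^bsub>presented_group X R\<^esub> B \<in> carrier (presented_group X R)"
    if "A \<in> carrier (presented_group X R)" "B \<in> carrier (presented_group X R)" for A B
    using that by (auto simp: carr presented_group_mult)
  show "A \<otimes>\<^bsub>presented_group X R\<^esub> B \<otimes>\<^bsub>presented_group X R\<^esub> C
      = A \<otimes>\<^bsub>presented_group X R\<^esub> (B \<otimes>\<^bsub>presented_group X R\<^esub> C)"
    if "A \<in> carrier (presented_group X R)" "B \<in> carrier (presented_group X R)"
       "C \<in> carrier (presented_group X R)" for A B C
    using that by (auto simp: carr presented_group_mult)
qed

fun gword_eval :: "('b, 'c) monoid_scheme \<Rightarrow> ('a \<Rightarrow> 'b) \<Rightarrow> 'a gword \<Rightarrow> 'b" where
  "gword_eval G f [] = \<one>\<^bsub>G\<^esub>"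
| "gword_eval G f ((x, e) # u) = (if e then f x else inv\<^bsub>G\<^esub> (f x)) \<otimes>\<^bsub>G\<^esub> gword_eval G f u"

text \<open>Von Dyck's theorem.\<close>

theorem presented_group_von_dyck:
  fixes G (structure)
  assumes "group G" and f: "f \<in> X \<rightarrow> carrier G"
    and rel: "\<And>u v. (u, v) \<in> R \<Longrightarrow> u \<in> gwords X \<Longrightarrow> v \<in> gwords X \<Longrightarrow>
      gword_eval G f u = gword_eval G f v"
  shows "\<exists>h\<in>hom (presented_group X R) G. \<forall>x\<in>X. h (pres_gen X R x) = f x"
proof -
  interpret group G by fact
  have cl: "gword_eval G f u \<in> carrier G" if "u \<in> gwords X" for u
    using that
  proof (induction u)
    case (Cons p u)
    then have "f (fst p) \<in> carrier G" using f by auto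
    with Cons show ?case by (cases p) auto
  qed simp
  have app: "gword_eval G f (u @ v) = gword_eval G f u \<otimes> gword_eval G f v"
    if "u \<in> gwords X" "v \<in> gwords X" for u v
    using that(1)
  proof (induction u)
    case (Cons p u)
    then have "f (fst p) \<in> carrier G" using f by auto
    with Cons that(2) show ?case
      by (cases p) (auto simp: cl m_assoc)
  qed (simp add: cl that)
  have cong: "gword_eval G f u = gword_eval G f v" if "pres_cong X R u v" for u v
    using that
  proof (induction rule: pres_cong.induct)
    case (append u u' v v')
    then show ?case
      using pres_cong_gwords[of X R u u'] pres_cong_gwords[of X R v v'] by (simp add: app)
  next
    case (cancel x e)
    then have "f x \<in> carrier G" using f by auto
    then show ?case by simp
  qed (auto intro: rel)
  define h where "h A = gword_eval G f (SOME u. u \<in> A)" for A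
  have h: "h (pres_class X R u) = gword_eval G f u" if "u \<in> gwords X" for u
  proof -
    have "(SOME v. v \<in> pres_class X R u) \<in> pres_class X R u"
      using pres_cong.refl[OF that, of R] by (rule_tac someI[where x = u]) (simp add: pres_class_def)
    then have "pres_cong X R u (SOME v. v \<in> pres_class X R u)"
      by (simp add: pres_class_def)
    from cong[OF this] show ?thesis
      by (simp add: h_def)
  qed
  have "h \<in> hom (presented_group X R) G"
  proof (rule homI)
    fix A assume "A \<in> carrier (presented_group X R)"
    then show "h A \<in> carrier G" by (auto simp: presented_group_def h cl)
  next
    fix A B assume "A \<in> carrier (presented_group X R)" "B \<in> carrier (presented_group X R)"
    then obtain u v where "u \<in> gwords X" "A = pres_class X R u" "v \<in> gwords X" "B = pres_class X R v"
      by (auto simp: presented_group_def)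
    then show "h (A \<otimes>\<^bsub>presented_group X R\<^esub> B) = h A \<otimes> h B"
      by (simp add: presented_group_mult h app)
  qed
  moreover have "h (pres_gen X R x) = f x" if "x \<in> X" for x
    using that funcset_mem[OF f that] by (simp add: pres_gen_def h)
  ultimately show ?thesis by blast
qed


section \<open>The triplet group and its local representations\<close>

definition triplet_relations :: "nat \<Rightarrow> (nat gword \<times> nat gword) set" where
  "triplet_relations n =
    {([(i, True), (i, True)], []) | i. 1 \<le> i \<and> i \<le> n - 1} \<union>
    {([(i, True), (i + 1, True), (i, True)], [(i + 1, True), (i, True), (i + 1, True)])
      | i. 1 \<le> i \<and> i \<le> n - 2}"

definition triplet_group :: "nat \<Rightarrow> nat gword set monoid" where
  "triplet_group n = presented_group {1..n - 1} (triplet_relations n)"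

definition triplet_gen :: "nat \<Rightarrow> nat \<Rightarrow> nat gword set" where
  "triplet_gen n i = pres_gen {1..n - 1} (triplet_relations n) i"

lemma triplet_gen_involution:
  assumes "1 \<le> i" "i \<le> n - 1"
  shows "triplet_gen n i \<otimes>\<^bsub>triplet_group n\<^esub> triplet_gen n i = \<one>\<^bsub>triplet_group n\<^esub>"
proof -
  let ?R = "triplet_relations n"
  have "pres_cong {1..n - 1} ?R [(i, True), (i, True)] []"
    using assms by (intro pres_cong.relation) (auto simp: triplet_relations_def)
  then have "pres_class {1..n - 1} ?R [(i, True), (i, True)] = pres_class {1..n - 1} ?R []"
    using assms by (subst pres_class_eq_iff) auto
  moreover have "\<one>\<^bsub>triplet_group n\<^esub> = pres_class {1..n - 1} ?R []"
    by (simp add: triplet_group_def presented_group_def)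
  ultimately show ?thesis
    using assms by (simp add: triplet_group_def triplet_gen_def pres_gen_def presented_group_mult)
qed

lemma triplet_gen_braid:
  assumes "1 \<le> i" "i \<le> n - 2"
  shows "triplet_gen n i \<otimes>\<^bsub>triplet_group n\<^esub> triplet_gen n (i + 1) \<otimes>\<^bsub>triplet_group n\<^esub> triplet_gen n i
    = triplet_gen n (i + 1) \<otimes>\<^bsub>triplet_group n\<^esub> triplet_gen n i \<otimes>\<^bsub>triplet_group n\<^esub> triplet_gen n (i + 1)"
proof -
  let ?R = "triplet_relations n"
  let ?u = "[(i, True), (i + 1, True), (i, True)]"
  let ?v = "[(i + 1, True), (i, True), (i + 1, True)]"
  have i: "i \<in> {1..n - 1}" "i + 1 \<in> {1..n - 1}"
    using assms by auto
  have "pres_cong {1..n - 1} ?R ?u ?v"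
  proof (rule pres_cong.relation)
    show "(?u, ?v) \<in> ?R" using assms unfolding triplet_relations_def by blast
  qed (use i in simp_all)
  then have "pres_class {1..n - 1} ?R ?u = pres_class {1..n - 1} ?R ?v"
    using i by (subst pres_class_eq_iff) simp_all
  then show ?thesis
    using i by (simp add: triplet_group_def triplet_gen_def pres_gen_def presented_group_mult)
qed

abbreviation GL :: "nat \<Rightarrow> complex mat monoid" where
  "GL n \<equiv> units_of (ring_mat TYPE(complex) n ())"

text \<open>The block diagonal matrix with diagonal blocks \<open>I\<^sub>i\<^sub>-\<^sub>1\<close>, \<open>M\<close>, \<open>I\<^sub>n\<^sub>-\<^sub>i\<^sub>-\<^sub>1\<close>; of size \<open>n\<close> if
  \<open>M\<close> is \<open>2 \<times> 2\<close> and \<open>1 \<le> i \<le> n - 1\<close>.\<close>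

definition local_block :: "nat \<Rightarrow> nat \<Rightarrow> complex mat \<Rightarrow> complex mat" where
  "local_block n i M = diag_block_mat [1\<^sub>m (i - 1), M, 1\<^sub>m (n - i - 1)]"

definition triplet_rep :: "nat \<Rightarrow> (nat gword set \<Rightarrow> complex mat) \<Rightarrow> bool" where
  "triplet_rep n \<rho> \<longleftrightarrow> \<rho> \<in> hom (triplet_group n) (GL n)"

definition has_local_blocks ::
    "nat \<Rightarrow> (nat gword set \<Rightarrow> complex mat) \<Rightarrow> (nat \<Rightarrow> complex mat) \<Rightarrow> bool" where
  "has_local_blocks n \<rho> M \<longleftrightarrow>
    (\<forall>i\<in>{1..n - 1}. M i \<in> carrier (GL 2) \<and> \<rho> (triplet_gen n i) = local_block n i (M i))"

definition homogeneous_two_local :: "nat \<Rightarrow> (nat gword set \<Rightarrow> complex mat) \<Rightarrow> bool" where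
  "homogeneous_two_local n \<rho> \<longleftrightarrow>
    (\<exists>M. has_local_blocks n \<rho> M \<and> (\<forall>i\<in>{1..n - 1}. \<forall>j\<in>{1..n - 1}. M i = M j))"

definition nontrivial_rep :: "nat \<Rightarrow> (nat gword set \<Rightarrow> complex mat) \<Rightarrow> bool" where
  "nontrivial_rep n \<rho> \<longleftrightarrow> \<not> (\<forall>i\<in>{1..n - 1}. \<rho> (triplet_gen n i) = 1\<^sub>m n)"

end

theory Submission
  imports Defs
begin

text \<open>
  Write \<open>M\<close> for the common block, with entries \<open>a, b\<close> in the first row and \<open>c, d\<close> in the second.
  As \<open>n \<ge> 3\<close>, the generators \<open>\<ell>\<^sub>1\<close> and \<open>\<ell>\<^sub>2\<close> both exist, and their images act on the first three
  coordinates only, so that the relations \<open>\<ell>\<^sub>1\<^sup>2 = 1\<close> and \<open>\<ell>\<^sub>1\<ell>\<^sub>2\<ell>\<^sub>1 = \<ell>\<^sub>2\<ell>\<^sub>1\<ell>\<^sub>2\<close> become polynomial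
  equations in \<open>a, b, c, d\<close>.

  The first relation says \<open>M\<^sup>2 = I\<close>. In particular \<open>b (a + d) = c (a + d) = 0\<close>, so that \<open>d = -a\<close>
  unless \<open>M\<close> is diagonal. The off-diagonal entries of the braid relation give
  \<open>a b d = a c d = 0\<close>. If \<open>M\<close> is not diagonal, these two facts force \<open>a = d = 0\<close> and then \<open>b c = 1\<close>,
  which is the asserted form. If \<open>M\<close> is diagonal, the corner entries of the braid relation
  give \<open>a\<^sup>2 = a\<close> and \<open>d\<^sup>2 = d\<close>; together with \<open>a\<^sup>2 = d\<^sup>2 = 1\<close> this makes \<open>M\<close> the identity, and then
  the representation is trivial.
\<close>

lemma index_local_block:
  assumes "M \<in> carrier_mat 2 2" "1 \<le> i" "i \<le> n - 1" "r < n" "s < n"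
  shows "local_block n i M $$ (r, s) =
    (if r \<in> {i - 1, i} \<and> s \<in> {i - 1, i} then M $$ (r - (i - 1), s - (i - 1))
     else if r = s then 1 else 0)"
  using assms by (auto simp: local_block_def Let_def)

lemma local_block_carrier:
  assumes "M \<in> carrier_mat 2 2" "1 \<le> i" "i \<le> n - 1"
  shows "local_block n i M \<in> carrier_mat n n"
  using assms by (auto simp: local_block_def Let_def)

lemma local_block_one:
  assumes "1 \<le> i" "i \<le> n - 1"
  shows "local_block n i (1\<^sub>m 2) = 1\<^sub>m n"
proof (rule eq_matI)
  fix r s assume "r < dim_row (1\<^sub>m n :: complex mat)" "s < dim_col (1\<^sub>m n :: complex mat)"
  then show "local_block n i (1\<^sub>m 2) $$ (r, s) = 1\<^sub>m n $$ (r, s)"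
    using assms by (subst index_local_block) auto
qed (use local_block_carrier[OF one_carrier_mat assms] in auto)

text \<open>A row that vanishes beyond the third column reduces an \<open>n\<close>-term sum to three terms; this is
  how the computation with \<open>n \<times> n\<close> matrices becomes one with \<open>3 \<times> 3\<close> matrices.\<close>

lemma mult_index_three:
  fixes C D :: "'a :: semiring_1 mat"
  assumes "C \<in> carrier_mat n n" "D \<in> carrier_mat n n" "3 \<le> n" "r < n" "s < n"
    and zero: "\<And>k. 3 \<le> k \<Longrightarrow> k < n \<Longrightarrow> C $$ (r, k) = 0"
  shows "(C * D) $$ (r, s) = C $$ (r, 0) * D $$ (0, s) + C $$ (r, 1) * D $$ (1, s)
    + C $$ (r, 2) * D $$ (2, s)"
proof -
  have "(C * D) $$ (r, s) = (\<Sum>k = 0..<n. C $$ (r, k) * D $$ (k, s))"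
    using assms by (simp add: scalar_prod_def)
  also have "\<dots> = (\<Sum>k = 0..<3. C $$ (r, k) * D $$ (k, s))"
    using assms by (intro sum.mono_neutral_right) auto
  finally show ?thesis
    by (simp add: numeral_3_eq_3 numeral_2_eq_2)
qed

lemma involutive_local_block_entries:
  assumes M: "M \<in> carrier_mat 2 2" and n: "3 \<le> n"
    and inv: "local_block n 1 M * local_block n 1 M = 1\<^sub>m n"
  shows "M $$ (0,0) * M $$ (0,0) + M $$ (0,1) * M $$ (1,0) = 1"
    and "M $$ (0,1) * (M $$ (0,0) + M $$ (1,1)) = 0"
    and "M $$ (1,0) * (M $$ (0,0) + M $$ (1,1)) = 0"
    and "M $$ (1,0) * M $$ (0,1) + M $$ (1,1) * M $$ (1,1) = 1"
proof -
  let ?A = "local_block n 1 M"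
  have A: "?A \<in> carrier_mat n n"
    using local_block_carrier[OF M] n by simp
  note idx = index_local_block[OF M, of 1 n, unfolded One_nat_def]
  have eq: "?A $$ (r, 0) * ?A $$ (0, s) + ?A $$ (r, 1) * ?A $$ (1, s)
      + ?A $$ (r, 2) * ?A $$ (2, s) = 1\<^sub>m n $$ (r, s)" if "r < 3" "s < 3" for r s
    using inv n that by (subst mult_index_three[OF A A, symmetric]) (auto simp: idx)
  show "M $$ (0,0) * M $$ (0,0) + M $$ (0,1) * M $$ (1,0) = 1"
    using eq[of 0 0] n by (simp add: idx)
  show "M $$ (0,1) * (M $$ (0,0) + M $$ (1,1)) = 0"
    using eq[of 0 1] n by (simp add: idx algebra_simps)
  show "M $$ (1,0) * (M $$ (0,0) + M $$ (1,1)) = 0"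
    using eq[of 1 0] n by (simp add: idx algebra_simps)
  show "M $$ (1,0) * M $$ (0,1) + M $$ (1,1) * M $$ (1,1) = 1"
    using eq[of 1 1] n by (simp add: idx)
qed

text \<open>Four entries of the braid relation suffice to determine \<open>M\<close> when \<open>M\<^sup>2 = I\<close> and \<open>M \<noteq> I\<close>, up to
  the free parameter \<open>b\<close>: two corners settle the diagonal case, and one entry for each off-diagonal
  coefficient of \<open>M\<close> settles the other.\<close>

lemma braided_local_block_entries:
  assumes M: "M \<in> carrier_mat 2 2" and n: "3 \<le> n"
    and braid: "local_block n 1 M * local_block n 2 M * local_block n 1 M
      = local_block n 2 M * local_block n 1 M * local_block n 2 M"
  shows "M $$ (0,0) * M $$ (0,0) + M $$ (0,0) * M $$ (0,1) * M $$ (1,0) = M $$ (0,0)"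
    and "M $$ (0,0) * M $$ (0,1) * M $$ (1,1) = 0"
    and "M $$ (0,0) * M $$ (1,0) * M $$ (1,1) = 0"
    and "M $$ (1,1) * M $$ (1,1) + M $$ (0,1) * M $$ (1,0) * M $$ (1,1) = M $$ (1,1)"
proof -
  let ?A = "local_block n 1 M" and ?B = "local_block n 2 M"
  have A: "?A \<in> carrier_mat n n" and B: "?B \<in> carrier_mat n n"
    using local_block_carrier[OF M] n by simp_all
  note idx = index_local_block[OF M, of 1 n, unfolded One_nat_def] index_local_block[OF M, of 2 n]
  have Az: "?A $$ (r, k) = 0" and Bz: "?B $$ (r, k) = 0" if "r < 3" "3 \<le> k" "k < n" for r k
    using that n by (auto simp: idx)
  have Am: "(?A * D) $$ (r, s) = ?A $$ (r, 0) * D $$ (0, s) + ?A $$ (r, 1) * D $$ (1, s)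
      + ?A $$ (r, 2) * D $$ (2, s)" if "D \<in> carrier_mat n n" "r < 3" "s < 3" for D r s
    using that n by (intro mult_index_three[OF A]) (auto simp: Az[unfolded One_nat_def])
  have Bm: "(?B * D) $$ (r, s) = ?B $$ (r, 0) * D $$ (0, s) + ?B $$ (r, 1) * D $$ (1, s)
      + ?B $$ (r, 2) * D $$ (2, s)" if "D \<in> carrier_mat n n" "r < 3" "s < 3" for D r s
    using that n by (intro mult_index_three[OF B]) (auto simp: Bz)
  \<comment> \<open>Bracketed to the right, each product has \<open>?A\<close> or \<open>?B\<close> as its left factor, so that its first three
    rows expand into three terms by \<open>Am\<close> or \<open>Bm\<close>.\<close>
  have "?A * (?B * ?A) = ?B * (?A * ?B)"
    using braid A B by (simp add: assoc_mult_mat[of _ n n _ n _ n])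
  then have eq: "(?A * (?B * ?A)) $$ (r, s) = (?B * (?A * ?B)) $$ (r, s)" for r s
    by simp
  have AB: "?A * ?B \<in> carrier_mat n n" and BA: "?B * ?A \<in> carrier_mat n n"
    using A B by auto
  note expand = Am[OF BA, unfolded One_nat_def] Bm[OF AB, unfolded One_nat_def]
    Am[OF B, unfolded One_nat_def] Bm[OF A, unfolded One_nat_def] idx
  show "M $$ (0,0) * M $$ (0,0) + M $$ (0,0) * M $$ (0,1) * M $$ (1,0) = M $$ (0,0)"
    using eq[of 0 0] n by (simp add: expand del: index_mult_mat) (simp add: algebra_simps)
  show "M $$ (0,0) * M $$ (0,1) * M $$ (1,1) = 0"
    using eq[of 0 1] n by (simp add: expand del: index_mult_mat) (auto simp: algebra_simps)
  show "M $$ (0,0) * M $$ (1,0) * M $$ (1,1) = 0"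
    using eq[of 1 0] n by (simp add: expand del: index_mult_mat) (auto simp: algebra_simps)
  show "M $$ (1,1) * M $$ (1,1) + M $$ (0,1) * M $$ (1,0) * M $$ (1,1) = M $$ (1,1)"
    using eq[of 2 2] n by (simp add: expand del: index_mult_mat) (simp add: algebra_simps)
qed

text \<open>Either off-diagonal coefficient, if nonzero, cancels from both \<open>b (a + d) = 0\<close> and \<open>a b d = 0\<close>
  (or their analogues for \<open>c\<close>), leaving \<open>d = -a\<close> and \<open>a\<^sup>2 = 0\<close>.\<close>

lemma involutive_braided_scalars:
  fixes a b c d :: "'a :: idom"
  assumes inv: "a * a + b * c = 1" "b * (a + d) = 0" "c * (a + d) = 0" "c * b + d * d = 1"
    and braid: "a * a + a * b * c = a" "a * b * d = 0" "a * c * d = 0" "d * d + b * c * d = d"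
  shows "(a = 1 \<and> b = 0 \<and> c = 0 \<and> d = 1) \<or> (a = 0 \<and> d = 0 \<and> b * c = 1)"
proof (cases "b = 0 \<and> c = 0")
  case True
  then show ?thesis using inv braid by simp
next
  case False
  then have d: "d = - a"
    using inv by (auto simp: eq_neg_iff_add_eq_0 add.commute)
  have "a = 0"
    using False braid(2,3) d by auto
  then show ?thesis
    using inv d by simp
qed

lemma involutive_braided_local_block:
  assumes M: "M \<in> carrier_mat 2 2" and n: "3 \<le> n"
    and "local_block n 1 M * local_block n 1 M = 1\<^sub>m n"
    and "local_block n 1 M * local_block n 2 M * local_block n 1 M
      = local_block n 2 M * local_block n 1 M * local_block n 2 M"
  shows "M = 1\<^sub>m 2 \<or> (\<exists>b. b \<noteq> 0 \<and> M = mat_of_rows_list 2 [[0, b], [1 / b, 0]])"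
proof -
  consider "M $$ (0,0) = 1" "M $$ (0,1) = 0" "M $$ (1,0) = 0" "M $$ (1,1) = 1"
    | "M $$ (0,0) = 0" "M $$ (1,1) = 0" "M $$ (0,1) * M $$ (1,0) = 1"
    using involutive_braided_scalars[OF involutive_local_block_entries[OF assms(1-3)]
        braided_local_block_entries[OF assms(1,2,4)]]
    by blast
  then show ?thesis
  proof cases
    case 1
    have "M = 1\<^sub>m 2"
      using M 1 by (intro eq_matI) (auto simp: less_2_cases_iff)
    then show ?thesis ..
  next
    case 2
    then have b: "M $$ (0,1) \<noteq> 0" and c: "M $$ (1,0) = 1 / M $$ (0,1)"
      by (auto simp: eq_divide_eq mult.commute)
    have "M = mat_of_rows_list 2 [[0, M $$ (0,1)], [1 / M $$ (0,1), 0]]"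
      using M 2 c by (intro eq_matI) (auto simp: mat_of_rows_list_def less_Suc_eq numeral_2_eq_2)
    with b show ?thesis by blast
  qed
qed

lemma triplet_gen_carrier:
  "i \<in> {1..n - 1} \<Longrightarrow> triplet_gen n i \<in> carrier (triplet_group n)"
  by (auto simp: triplet_gen_def triplet_group_def pres_gen_def presented_group_def)

lemma GL_group: "group (GL n)"
proof -
  interpret ring "ring_mat TYPE(complex) n ()" by (rule ring_mat)
  show ?thesis by (rule units_group)
qed

lemma GL_mult: "A \<otimes>\<^bsub>GL n\<^esub> B = A * B"
  by (simp add: units_of_def ring_mat_simps)

lemma triplet_rep_involution:
  assumes "triplet_rep n \<rho>" "i \<in> {1..n - 1}"
  shows "\<rho> (triplet_gen n i) * \<rho> (triplet_gen n i) = 1\<^sub>m n"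
proof -
  have hom: "\<rho> \<in> hom (triplet_group n) (GL n)"
    using assms by (simp add: triplet_rep_def)
  have "group (triplet_group n)"
    by (simp add: triplet_group_def presented_group_group)
  then have "\<rho> \<one>\<^bsub>triplet_group n\<^esub> = \<one>\<^bsub>GL n\<^esub>"
    by (rule hom_one[OF hom _ GL_group])
  also have "\<dots> = 1\<^sub>m n"
    by (simp add: units_of_def ring_mat_simps)
  finally show ?thesis
    using hom_mult[OF hom triplet_gen_carrier triplet_gen_carrier, OF assms(2) assms(2)]
      triplet_gen_involution[of i n] assms(2)
    by (simp add: GL_mult)
qed

lemma triplet_rep_braid:
  assumes "triplet_rep n \<rho>" "1 \<le> i" "i \<le> n - 2"
  shows "\<rho> (triplet_gen n i) * \<rho> (triplet_gen n (i + 1)) * \<rho> (triplet_gen n i)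
    = \<rho> (triplet_gen n (i + 1)) * \<rho> (triplet_gen n i) * \<rho> (triplet_gen n (i + 1))"
proof -
  have hom: "\<rho> \<in> hom (triplet_group n) (GL n)"
    using assms by (simp add: triplet_rep_def)
  interpret group "triplet_group n"
    by (simp add: triplet_group_def presented_group_group)
  have gen: "triplet_gen n i \<in> carrier (triplet_group n)"
    "triplet_gen n (i + 1) \<in> carrier (triplet_group n)"
    using assms by (auto intro!: triplet_gen_carrier)
  show ?thesis
    using arg_cong[OF triplet_gen_braid[OF assms(2,3)], of \<rho>] gen
    by (simp add: hom_mult[OF hom] GL_mult)
qed

theorem theorem19:
  fixes n :: nat and \<rho> :: "nat gword set \<Rightarrow> complex mat"
  assumes "n \<ge> 3"
    and "triplet_rep n \<rho>"
    and "homogeneous_two_local n \<rho>"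
    and "nontrivial_rep n \<rho>"
  shows "\<exists>b::complex. b \<noteq> 0 \<and>
    (\<forall>i\<in>{1..n - 1}.
      \<rho> (triplet_gen n i) = local_block n i (mat_of_rows_list 2 [[0, b], [1 / b, 0]]))"
proof -
  obtain N where N: "has_local_blocks n \<rho> N"
    and hom: "\<forall>i\<in>{1..n - 1}. \<forall>j\<in>{1..n - 1}. N i = N j"
    using assms(3) by (auto simp: homogeneous_two_local_def)
  define M where "M = N 1"
  have one: "1 \<in> {1..n - 1}" and two: "2 \<in> {1..n - 1}"
    using assms(1) by auto
  have \<rho>: "\<rho> (triplet_gen n i) = local_block n i M" if "i \<in> {1..n - 1}" for i
    using N hom one that unfolding has_local_blocks_def M_def by metis
  have "M \<in> carrier (GL 2)"
    using N one unfolding has_local_blocks_def M_def by blast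
  then have M: "M \<in> carrier_mat 2 2"
    by (simp add: units_of_def Units_def ring_mat_simps)
  have "local_block n 1 M * local_block n 1 M = 1\<^sub>m n"
    using triplet_rep_involution[OF assms(2) one] \<rho>[OF one] by simp
  moreover have "local_block n 1 M * local_block n 2 M * local_block n 1 M
      = local_block n 2 M * local_block n 1 M * local_block n 2 M"
    using triplet_rep_braid[OF assms(2), of 1] assms(1) \<rho>[OF one] \<rho>[OF two]
    by (simp add: numeral_2_eq_2)
  moreover have "M \<noteq> 1\<^sub>m 2"
    using assms(4) \<rho> local_block_one by (auto simp: nontrivial_rep_def)
  ultimately show ?thesis
    using involutive_braided_local_block[OF M assms(1)] \<rho> by blast
qed

end
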